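(* Let $\mathscr A\subseteq\mathscr P(\mathscr X)$ be a non-empty set of propositions, and consider the AD-assessment $A_{\mathscr A}:=\langle\{\mathbb I_B-1:B\in\mathscr A\};\emptyset\rangle$ of gambles on $\mathscr X$. Then $A_{\mathscr A}$ is $V$-consistent if and only if $\emptyset\notin\mathscr C_{\mathscr A}$ (in other words, if and only if $\mathscr A$ is logically consistent). In that case, the $V$-natural extension of $A_{\mathscr A}$ is given by $$\mathrm{cl}_{\mathbf M}(A_{\mathscr A}\cup V)=\big\langle\mathscr G_{\geq0}^{\mathscr F_{\mathscr A}}\,;\,-\mathscr G_{\gtrdot0}^{\mathscr F_{\mathscr A}}\big\rangle .$$
   Context: $\mathscr X$ is a non-empty set; $\mathscr G$ is the real linear space of all gambles, i.e. bounded maps $f:\mathscr X\to\mathbb R$; $\mathbb I_B$ is the indicator of $B\subseteq\mathscr X$, and real numbers are identified with constant gambles. $\mathscr G_{\geq0}=\{f:\inf f\geq0\}$, $\mathscr G_{\gtrdot0}=\{f:\inf f>0\}$. For non-empty $B$, $\inf(f\vert B)=\inf\{f(x):x\in B\}$. For $A,B\subseteq\mathscr G$: $-A$, $A+B$, $A-B$ are taken elementwise (Minkowski); $\mathrm{posi}(B)$ is the set of all finite (non-empty) linear combinations of elements of $B$ with strictly positive coefficients; $\mathrm{sh}(B)=\{\lambda f:f\in B,\lambda>0\}$. A convex cone is a set closed under addition and under multiplication by strictly positive reals. An assessment is a pair $A=\langle A_{\mathrm{acc}};A_{\mathrm{rej}}\rangle$ of subsets of $\mathscr G$; inclusion, union,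 intersection are componentwise; $A_{\mathrm{des}}=A_{\mathrm{acc}}\cap(-A_{\mathrm{rej}})$. It is an AD-assessment if $A_{\mathrm{rej}}\subseteq-A_{\mathrm{acc}}$. A statement model is an assessment $M$ with $0\in M_{\mathrm{acc}}$, $0\notin M_{\mathrm{rej}}$, $M_{\mathrm{acc}}$ a convex cone, and $\mathrm{sh}(M_{\mathrm{rej}})-M_{\mathrm{acc}}\subseteq M_{\mathrm{rej}}$; $\mathbf M$ is the set of all statement models. $\mathrm{cl}_{\mathbf M}(A)$ is the intersection of all statement models including $A$ (and $\langle\mathscr G;\mathscr G\rangle$ if there are none). The background is $V=\langle\mathscr G_{\geq0};-\mathscr G_{\gtrdot0}\rangle$. $A$ is $V$-consistent if $\mathrm{posi}(A_{\mathrm{acc}}\cup V_{\mathrm{acc}})\cap(A_{\mathrm{rej}}\cup V_{\mathrm{rej}})=\emptyset$; its $V$-natural extension is then $\mathrm{cl}_{\mathbf M}(A\cup V)$. Propositions are subsets of $\mathscr X$. $\mathscr C_{\mathscr A}:=\{\bigcap_{k=1}^nA_k:n\in\mathbb N,n\ge1,A_k\in\mathscr A\}$ and $\mathscr F_{\mathscr A}:=\{A\subseteq\mathscr X:\exists B\in\mathscr C_{\mathscr A},\,B\subseteq A\}$. For a collection $\mathscr F$ of non-empty subsets of $\mathscr X$: $\mathscr G_{\geq0}^{\mathscr F}:=\{f\in\mathscr G:\exists B\in\mathscr F,\ \inf(f\vert B)\geq0\}$ and $\mathscr G_{\gtrdot0}^{\mathscr F}:=\{f\in\mathscr G:\exists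 B\in\mathscr F,\ \inf(f\vert B)>0\}$. *)

theory Defs
  imports "HOL-Analysis.Analysis" "HOL-Library.Product_Order"
begin

section \<open>Gambles\<close>

text \<open>The possibility space is the type \<open>'x\<close>, which is non-empty like every type.\<close>

typedef 'x gamble = "{f :: 'x \<Rightarrow> real. bounded (range f)}"
  morphisms apply_gamble Gamble
  by (rule exI[of _ "\<lambda>_. 0"]) auto

setup_lifting type_definition_gamble

instantiation gamble :: (type) real_vector
begin

lift_definition zero_gamble :: "'a gamble" is "\<lambda>_. 0"
  by auto

lift_definition plus_gamble :: "'a gamble \<Rightarrow> 'a gamble \<Rightarrow> 'a gamble" is "\<lambda>f g x. f x + g x"
  by (rule bounded_plus_comp)

lift_definition uminus_gamble :: "'a gamble \<Rightarrow> 'a gamble" is "\<lambda>f x. - f x"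
  by (simp add: bounded_iff)

lift_definition minus_gamble :: "'a gamble \<Rightarrow> 'a gamble \<Rightarrow> 'a gamble" is "\<lambda>f g x. f x - g x"
  by (rule bounded_minus_comp)

lift_definition scaleR_gamble :: "real \<Rightarrow> 'a gamble \<Rightarrow> 'a gamble" is "\<lambda>c f x. c * f x"
  using bounded_scaleR_comp by fastforce

instance
  by standard (transfer, simp add: fun_eq_iff algebra_simps)+

end

lift_definition const_gamble :: "real \<Rightarrow> 'x gamble" is "\<lambda>c _. c"
  by auto

lift_definition indicator_gamble :: "'x set \<Rightarrow> 'x gamble" is "\<lambda>B. indicator B"
  by (auto simp: bounded_iff indicator_def intro!: exI[of _ 1])

text \<open>Only meaningful for non-empty \<open>B\<close>.\<close>

definition cond_inf :: "'x gamble \<Rightarrow> 'x set \<Rightarrow> real" where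
  "cond_inf f B = (INF x\<in>B. apply_gamble f x)"

definition gambles_nonneg :: "'x gamble set" where
  "gambles_nonneg = {f. (INF x. apply_gamble f x) \<ge> 0}"

definition gambles_pos :: "'x gamble set" where
  "gambles_pos = {f. (INF x. apply_gamble f x) > 0}"

section \<open>Assessments and statement models\<close>

text \<open>
  An assessment is a pair of an accept set and a reject set. Inclusion, union and intersection of
  assessments are the componentwise \<open>\<le>\<close>, \<open>sup\<close> and \<open>Inf\<close> of \<^theory>\<open>HOL-Library.Product_Order\<close>.
  On sets, \<open>-\<close> denotes complement and difference, so the elementwise operations are written
  as \<open>uminus ` A\<close> and \<open>minkowski_diff A B\<close>.
\<close>

type_synonym 'v assessment = "'v set \<times> 'v set"

abbreviation acc :: "'v assessment \<Rightarrow> 'v set" where "acc \<equiv> fst"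
abbreviation rej :: "'v assessment \<Rightarrow> 'v set" where "rej \<equiv> snd"

definition minkowski_diff :: "'v::real_vector set \<Rightarrow> 'v set \<Rightarrow> 'v set" where
  "minkowski_diff A B = {a - b | a b. a \<in> A \<and> b \<in> B}"

definition posi :: "'v::real_vector set \<Rightarrow> 'v set" where
  "posi B = {\<Sum>k=1..n. l k *\<^sub>R f k | (n::nat) l f.
     n \<ge> 1 \<and> (\<forall>k\<in>{1..n}. l k > 0 \<and> f k \<in> B)}"

definition sh :: "'v::real_vector set \<Rightarrow> 'v set" where
  "sh B = {l *\<^sub>R f | l f. l > 0 \<and> f \<in> B}"

text \<open>
  Unlike \<^const>\<open>convex_cone\<close>, this requires closure under strictly positive scaling only.
\<close>

definition pos_convex_cone :: "'v::real_vector set \<Rightarrow> bool" where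
  "pos_convex_cone C \<longleftrightarrow> (\<forall>f\<in>C. \<forall>g\<in>C. f + g \<in> C) \<and> (\<forall>f\<in>C. \<forall>l>0. l *\<^sub>R f \<in> C)"

definition AD_assessment :: "'v::real_vector assessment \<Rightarrow> bool" where
  "AD_assessment A \<longleftrightarrow> rej A \<subseteq> uminus ` acc A"

definition statement_model :: "'v::real_vector assessment \<Rightarrow> bool" where
  "statement_model M \<longleftrightarrow>
     0 \<in> acc M \<and> 0 \<notin> rej M \<and> pos_convex_cone (acc M) \<and>
     minkowski_diff (sh (rej M)) (acc M) \<subseteq> rej M"

text \<open>If no statement model includes \<open>A\<close>, the infimum is \<open>Inf {} = (UNIV, UNIV)\<close>.\<close>

definition cl_M :: "'v::real_vector assessment \<Rightarrow> 'v assessment" where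
  "cl_M A = Inf {M. statement_model M \<and> A \<le> M}"

definition background :: "'x gamble assessment" where
  "background = (gambles_nonneg, uminus ` gambles_pos)"

definition consistent :: "'v::real_vector assessment \<Rightarrow> 'v assessment \<Rightarrow> bool" where
  "consistent V A \<longleftrightarrow> posi (acc A \<union> acc V) \<inter> (rej A \<union> rej V) = {}"

text \<open>Only meaningful for \<open>V\<close>-consistent \<open>A\<close>.\<close>

definition natural_extension :: "'v::real_vector assessment \<Rightarrow> 'v assessment \<Rightarrow> 'v assessment"
  where "natural_extension V A = cl_M (sup A V)"

section \<open>Propositional assessments\<close>

definition conjunctions :: "'x set set \<Rightarrow> 'x set set" where
  "conjunctions \<A> = {(\<Inter>k\<in>{1..n}. S k) | (n::nat) S. n \<ge> 1 \<and> (\<forall>k\<in>{1..n}. S k \<in> \<A>)}"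

definition generated_filter :: "'x set set \<Rightarrow> 'x set set" where
  "generated_filter \<A> = {A. \<exists>B\<in>conjunctions \<A>. B \<subseteq> A}"

definition gambles_nonneg_on :: "'x set set \<Rightarrow> 'x gamble set" where
  "gambles_nonneg_on \<F> = {f. \<exists>B\<in>\<F>. cond_inf f B \<ge> 0}"

definition gambles_pos_on :: "'x set set \<Rightarrow> 'x gamble set" where
  "gambles_pos_on \<F> = {f. \<exists>B\<in>\<F>. cond_inf f B > 0}"

definition prop_assessment :: "'x set set \<Rightarrow> 'x gamble assessment" where
  "prop_assessment \<A> = ({indicator_gamble B - const_gamble 1 | B. B \<in> \<A>}, {})"

lemma AD_prop_assessment: "AD_assessment (prop_assessment \<A>)"
  by (simp add: AD_assessment_def prop_assessment_def)

end

theory Submission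
  imports Defs
begin

text \<open>
  For a conjunction \<open>B\<close> of propositions \<open>S 1, \<dots>, S n\<close> from \<open>\<A>\<close>, the sum of the gambles
  \<open>\<I>\<^bsub>S k\<^esub> - 1\<close> is acceptable, is at most \<open>0\<close> everywhere and at most \<open>-1\<close> outside \<open>B\<close>. If \<open>B\<close> is
  empty, this sum is an acceptable gamble that the background rejects. In general, subtracting a
  large multiple of it from a gamble that is nonnegative (bounded away from zero) on \<open>B\<close> gives a
  gamble that is nonnegative (bounded away from zero) everywhere, which is why every statement
  model including the assessment contains the claimed one.
\<close>

section \<open>Gambles\<close>

lemma apply_gamble_simps [simp]:
  "apply_gamble 0 x = 0"
  "apply_gamble (f + g) x = apply_gamble f x + apply_gamble g x"
  "apply_gamble (f - g) x = apply_gamble f x - apply_gamble g x"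
  "apply_gamble (- f) x = - apply_gamble f x"
  "apply_gamble (c *\<^sub>R f) x = c * apply_gamble f x"
  "apply_gamble (const_gamble c) x = c"
  "apply_gamble (indicator_gamble B) x = indicator B x"
  by (transfer, simp)+

lemma apply_gamble_sum: "apply_gamble (sum f I) x = (\<Sum>i\<in>I. apply_gamble (f i) x)"
  by (induction I rule: infinite_finite_induct) simp_all

lemma gamble_bounded:
  obtains c where "c > 0" "\<And>x. \<bar>apply_gamble f x\<bar> \<le> c"
proof -
  have "bounded (range (apply_gamble f))"
    using apply_gamble by auto
  then show thesis
    using that unfolding bounded_pos by auto
qed

lemma cond_inf_ge_iff:
  assumes "B \<noteq> {}"
  shows "c \<le> cond_inf f B \<longleftrightarrow> (\<forall>x\<in>B. c \<le> apply_gamble f x)"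
proof -
  obtain b where "\<And>x. \<bar>apply_gamble f x\<bar> \<le> b"
    using gamble_bounded[of f] by metis
  then have "\<And>x. - b \<le> apply_gamble f x"
    by (simp add: abs_le_iff minus_le_iff)
  then have "bdd_below (apply_gamble f ` B)"
    by (rule bdd_belowI2)
  then show ?thesis
    unfolding cond_inf_def using assms by (simp add: le_cINF_iff)
qed

text \<open>The infimum need not be attained, so strictness amounts to a uniform gap; from left to
  right the infimum itself serves as \<open>d\<close>.\<close>

lemma cond_inf_gt_iff:
  assumes "B \<noteq> {}"
  shows "c < cond_inf f B \<longleftrightarrow> (\<exists>d>c. \<forall>x\<in>B. d \<le> apply_gamble f x)"
  using cond_inf_ge_iff[OF assms, of _ f] by (metis order.strict_trans2 order_refl)

lemma gambles_nonneg_iff: "f \<in> gambles_nonneg \<longleftrightarrow> (\<forall>x. 0 \<le> apply_gamble f x)"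
  using cond_inf_ge_iff[of UNIV 0 f] by (simp add: gambles_nonneg_def cond_inf_def)

lemma gambles_pos_iff: "f \<in> gambles_pos \<longleftrightarrow> (\<exists>d>0. \<forall>x. d \<le> apply_gamble f x)"
  using cond_inf_gt_iff[of UNIV 0 f] by (simp add: gambles_pos_def cond_inf_def)

text \<open>Conjunctions belong to the filter and every filter member contains one, so a property
  inherited by subsets can be tested on conjunctions alone. The pointwise bounds below are of this
  kind.\<close>

lemma bex_generated_filter_iff:
  assumes "\<And>B C. P B \<Longrightarrow> C \<subseteq> B \<Longrightarrow> P C"
  shows "(\<exists>B\<in>generated_filter \<A>. P B) \<longleftrightarrow> (\<exists>B\<in>conjunctions \<A>. P B)"
  unfolding generated_filter_def using assms by blast

text \<open>The assumption makes every filter member non-empty, where \<open>cond_inf\<close> is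
  meaningful and can be replaced by a pointwise bound.\<close>

lemma gambles_nonneg_on_generated_filter_iff:
  assumes "{} \<notin> conjunctions \<A>"
  shows "f \<in> gambles_nonneg_on (generated_filter \<A>) \<longleftrightarrow>
    (\<exists>B\<in>conjunctions \<A>. \<forall>x\<in>B. 0 \<le> apply_gamble f x)"
proof -
  have "B \<noteq> {}" if "B \<in> generated_filter \<A>" for B
    using that assms by (auto simp: generated_filter_def)
  then have "f \<in> gambles_nonneg_on (generated_filter \<A>) \<longleftrightarrow>
      (\<exists>B\<in>generated_filter \<A>. \<forall>x\<in>B. 0 \<le> apply_gamble f x)"
    by (simp add: gambles_nonneg_on_def cond_inf_ge_iff cong: bex_cong)
  also have "\<dots> \<longleftrightarrow> (\<exists>B\<in>conjunctions \<A>. \<forall>x\<in>B. 0 \<le> apply_gamble f x)"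
    by (rule bex_generated_filter_iff) blast
  finally show ?thesis .
qed

lemma gambles_pos_on_generated_filter_iff:
  assumes "{} \<notin> conjunctions \<A>"
  shows "f \<in> gambles_pos_on (generated_filter \<A>) \<longleftrightarrow>
    (\<exists>B\<in>conjunctions \<A>. \<exists>d>0. \<forall>x\<in>B. d \<le> apply_gamble f x)"
proof -
  have "B \<noteq> {}" if "B \<in> generated_filter \<A>" for B
    using that assms by (auto simp: generated_filter_def)
  then have "f \<in> gambles_pos_on (generated_filter \<A>) \<longleftrightarrow>
      (\<exists>B\<in>generated_filter \<A>. \<exists>d>0. \<forall>x\<in>B. d \<le> apply_gamble f x)"
    by (simp add: gambles_pos_on_def cond_inf_gt_iff cong: bex_cong)
  also have "\<dots> \<longleftrightarrow> (\<exists>B\<in>conjunctions \<A>. \<exists>d>0. \<forall>x\<in>B. d \<le> apply_gamble f x)"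
    by (rule bex_generated_filter_iff) blast
  finally show ?thesis .
qed

section \<open>Assessments\<close>

lemma posi_subset_pos_convex_cone:
  assumes "pos_convex_cone C" "B \<subseteq> C"
  shows "posi B \<subseteq> C"
proof
  fix h assume "h \<in> posi B"
  then obtain n :: nat and l f where h: "h = (\<Sum>k=1..n. l k *\<^sub>R f k)" "n \<ge> 1"
    and lf: "\<And>k. k \<in> {1..n} \<Longrightarrow> l k > 0 \<and> f k \<in> B"
    unfolding posi_def by blast
  have scaled: "l k *\<^sub>R f k \<in> C" if "k \<in> {1..n}" for k
    using lf[OF that] assms by (auto simp: pos_convex_cone_def)
  \<comment> \<open>The induction starts at 1 because a \<open>pos_convex_cone\<close> need not
    contain the empty sum 0.\<close>
  have "m \<le> n \<longrightarrow> (\<Sum>k=1..m. l k *\<^sub>R f k) \<in> C" if "1 \<le> m" for m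
    using that
  proof (induction m rule: dec_induct)
    case base
    then show ?case using scaled by simp
  next
    case (step m)
    then show ?case
      using scaled[of "Suc m"] assms(1) by (auto simp: pos_convex_cone_def)
  qed
  then show "h \<in> C" using h by simp
qed

lemma posi_mono: "B \<subseteq> C \<Longrightarrow> posi B \<subseteq> posi C"
  unfolding posi_def by blast

text \<open>Turns the computation of a closure into the exhibition of a least statement
  model.\<close>

lemma cl_M_eqI:
  assumes "statement_model N" "A \<le> N"
    and "\<And>M. statement_model M \<Longrightarrow> A \<le> M \<Longrightarrow> N \<le> M"
  shows "cl_M A = N"
  unfolding cl_M_def using assms by (intro antisym Inf_lower Inf_greatest) auto

section \<open>Propositional assessments\<close>

lemma conjunctions_superset: "\<A> \<subseteq> conjunctions \<A>"
proof
  fix B assume "B \<in> \<A>"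
  then have "B = (\<Inter>k\<in>{1..1::nat}. (\<lambda>_. B) k) \<and> (1::nat) \<le> 1 \<and> (\<forall>k\<in>{1..1::nat}. (\<lambda>_. B) k \<in> \<A>)"
    by simp
  then show "B \<in> conjunctions \<A>"
    unfolding conjunctions_def by blast
qed

lemma conjunctions_Int:
  assumes "B \<in> conjunctions \<A>" "C \<in> conjunctions \<A>"
  shows "B \<inter> C \<in> conjunctions \<A>"
proof -
  obtain m n :: nat and S T where B: "B = (\<Inter>k\<in>{1..m}. S k)" "m \<ge> 1" "\<forall>k\<in>{1..m}. S k \<in> \<A>"
    and C: "C = (\<Inter>k\<in>{1..n}. T k)" "n \<ge> 1" "\<forall>k\<in>{1..n}. T k \<in> \<A>"
    using assms unfolding conjunctions_def by blast
  \<comment> \<open>The two families are concatenated: \<open>S\<close> fills the indices up to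
    \<open>m\<close>, and \<open>T\<close> follows, shifted by \<open>m\<close>.\<close>
  define U where "U k = (if k \<le> m then S k else T (k - m))" for k
  have "{1..m + n} = {1..m} \<union> (\<lambda>k. k + m) ` {1..n}"
    by (auto simp: image_iff intro!: bexI[of _ "_ - m"])
  moreover have "(\<Inter>k\<in>{1..m}. U k) = B"
    by (auto simp: U_def B(1))
  moreover have "(\<Inter>k\<in>(\<lambda>k. k + m) ` {1..n}. U k) = C"
    unfolding C(1) INF_image o_def by (intro INF_cong) (auto simp: U_def)
  ultimately have "B \<inter> C = (\<Inter>k\<in>{1..m + n}. U k)"
    by (simp only: INF_union)
  moreover have "\<forall>k\<in>{1..m + n}. U k \<in> \<A>"
  proof
    fix k assume "k \<in> {1..m + n}"
    then have "k \<in> {1..m} \<or> k > m \<and> k - m \<in> {1..n}"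
      by auto
    then show "U k \<in> \<A>"
      using B(3) C(3) by (auto simp: U_def)
  qed
  ultimately show ?thesis
    using B(2) unfolding conjunctions_def by (intro CollectI exI[of _ "m + n"]) auto
qed

text \<open>A point outside \<open>B\<close> misses some \<open>S j\<close>; that summand is -1
  there, and the other summands, being nonpositive, cannot compensate.\<close>

lemma conjunctions_penalty:
  assumes "B \<in> conjunctions \<A>"
  obtains s where "s \<in> posi (acc (prop_assessment \<A>))"
    "\<And>x. apply_gamble s x \<le> 0" "\<And>x. x \<notin> B \<Longrightarrow> apply_gamble s x \<le> -1"
proof -
  obtain n :: nat and S where B: "B = (\<Inter>k\<in>{1..n}. S k)" "n \<ge> 1" "\<forall>k\<in>{1..n}. S k \<in> \<A>"
    using assms unfolding conjunctions_def by blast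
  define g where "g k = indicator_gamble (S k) - const_gamble 1" for k
  \<comment> \<open>The coefficient 1 gives the sum the shape required by
    \<open>posi\<close>.\<close>
  define s where "s = (\<Sum>k=1..n. 1 *\<^sub>R g k)"
  have g_le: "apply_gamble (g k) x \<le> 0" for k x
    by (simp add: g_def indicator_def)
  show thesis
  proof
    have "\<forall>k\<in>{1..n}. (0::real) < 1 \<and> g k \<in> acc (prop_assessment \<A>)"
      using B(3) by (auto simp: prop_assessment_def g_def)
    then show "s \<in> posi (acc (prop_assessment \<A>))"
      using B(2) unfolding posi_def s_def
      by (intro CollectI exI[of _ n] exI[of _ "\<lambda>_. 1"] exI[of _ g]) simp
  next
    fix x
    show "apply_gamble s x \<le> 0"
      by (simp add: s_def apply_gamble_sum g_le sum_nonpos)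
  next
    fix x assume "x \<notin> B"
    then obtain j where j: "j \<in> {1..n}" "x \<notin> S j" using B(1) by auto
    have "apply_gamble s x = apply_gamble (g j) x + (\<Sum>k\<in>{1..n} - {j}. apply_gamble (g k) x)"
      using j(1) by (simp add: s_def apply_gamble_sum sum.remove)
    also have "\<dots> \<le> -1 + 0"
      using j(2) by (intro add_mono sum_nonpos g_le) (simp add: g_def)
    finally show "apply_gamble s x \<le> -1" by simp
  qed
qed

lemma not_consistent_if_empty_conjunction:
  assumes "{} \<in> conjunctions \<A>"
  shows "\<not> consistent background (prop_assessment \<A>)"
proof -
  \<comment> \<open>No point lies in the empty conjunction, so the bound -1 holds
    everywhere.\<close>
  obtain s where s: "s \<in> posi (acc (prop_assessment \<A>))" "\<And>x. apply_gamble s x \<le> -1"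
    using conjunctions_penalty[OF assms] by (metis empty_iff)
  have "1 \<le> apply_gamble (- s) x" for x
    using s(2)[of x] by simp
  then have "- s \<in> gambles_pos"
    unfolding gambles_pos_iff using zero_less_one by blast
  then have "- (- s) \<in> rej background"
    unfolding background_def snd_conv by (rule imageI)
  moreover have "s \<in> posi (acc (prop_assessment \<A>) \<union> acc background)"
    using s(1) posi_mono[OF Un_upper1] by blast
  ultimately show ?thesis
    unfolding consistent_def by auto
qed

section \<open>The candidate model and its minimality\<close>

abbreviation filter_model :: "'x set set \<Rightarrow> 'x gamble assessment" where
  "filter_model \<A> \<equiv>
    (gambles_nonneg_on (generated_filter \<A>), uminus ` gambles_pos_on (generated_filter \<A>))"

text \<open>Two gambles nonnegative on \<open>B\<close> and on \<open>C\<close> have a sum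
  nonnegative on \<open>B \<inter> C\<close>, again a conjunction; positive scaling keeps the same
  conjunction.\<close>

lemma pos_convex_cone_gambles_nonneg_on:
  assumes "{} \<notin> conjunctions \<A>"
  shows "pos_convex_cone (gambles_nonneg_on (generated_filter \<A>))"
  unfolding pos_convex_cone_def gambles_nonneg_on_generated_filter_iff[OF assms] Ball_def
proof (intro conjI allI impI; elim bexE)
  fix f g B C
  assume "B \<in> conjunctions \<A>" "C \<in> conjunctions \<A>"
    "\<forall>x. x \<in> B \<longrightarrow> 0 \<le> apply_gamble f x" "\<forall>x. x \<in> C \<longrightarrow> 0 \<le> apply_gamble g x"
  then show "\<exists>B\<in>conjunctions \<A>. \<forall>x. x \<in> B \<longrightarrow> 0 \<le> apply_gamble (f + g) x"
    by (intro bexI[of _ "B \<inter> C"] conjunctions_Int) auto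
next
  fix f B and l :: real
  assume "B \<in> conjunctions \<A>" "\<forall>x. x \<in> B \<longrightarrow> 0 \<le> apply_gamble f x" "0 < l"
  then show "\<exists>B\<in>conjunctions \<A>. \<forall>x. x \<in> B \<longrightarrow> 0 \<le> apply_gamble (l *\<^sub>R f) x"
    by (intro bexI[of _ B]) auto
qed

lemma statement_model_filter_model:
  assumes "\<A> \<noteq> {}" and consistent: "{} \<notin> conjunctions \<A>"
  shows "statement_model (filter_model \<A>)"
proof -
  note nonneg_iff = gambles_nonneg_on_generated_filter_iff[OF consistent]
  note pos_iff = gambles_pos_on_generated_filter_iff[OF consistent]
  \<comment> \<open>Since \<open>\<A>\<close> is non-empty, a conjunction exists to witness
    this.\<close>
  have "0 \<in> acc (filter_model \<A>)"
    using assms(1) conjunctions_superset by (fastforce simp: nonneg_iff)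
  \<comment> \<open>A positive lower bound for 0 fails at any point of a non-empty conjunction. As
    negation fixes 0, this also keeps 0 out of the reject set.\<close>
  moreover have "0 \<notin> gambles_pos_on (generated_filter \<A>)"
    unfolding pos_iff using consistent
    by (metis apply_gamble_simps(1) equals0I linorder_not_le)
  moreover have "minkowski_diff (sh (rej (filter_model \<A>))) (acc (filter_model \<A>))
    \<subseteq> rej (filter_model \<A>)"
  proof
    fix h assume "h \<in> minkowski_diff (sh (rej (filter_model \<A>))) (acc (filter_model \<A>))"
    then obtain l f g where h: "h = l *\<^sub>R (- f) - g" and l: "l > 0"
      and f: "f \<in> gambles_pos_on (generated_filter \<A>)"
      and g: "g \<in> gambles_nonneg_on (generated_filter \<A>)"
      unfolding minkowski_diff_def sh_def by auto
    obtain B d where B: "B \<in> conjunctions \<A>" "d > 0" "\<forall>x\<in>B. d \<le> apply_gamble f x"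
      using f pos_iff by blast
    obtain C where C: "C \<in> conjunctions \<A>" "\<forall>x\<in>C. 0 \<le> apply_gamble g x"
      using g nonneg_iff by blast
    \<comment> \<open>The gamble \<open>h\<close> is the negative of
      \<open>l *\<^sub>R f + g\<close>, which keeps the gap \<open>l * d\<close> on the common
      conjunction.\<close>
    have "l * d \<le> apply_gamble (l *\<^sub>R f + g) x" if "x \<in> B \<inter> C" for x
      using that B(3) C(2) l by (auto intro!: add_increasing2)
    then have "l *\<^sub>R f + g \<in> gambles_pos_on (generated_filter \<A>)"
      unfolding pos_iff using conjunctions_Int[OF B(1) C(1)] l B(2)
      by (intro bexI[of _ "B \<inter> C"] exI[of _ "l * d"]) auto
    then have "- (l *\<^sub>R f + g) \<in> rej (filter_model \<A>)"
      unfolding snd_conv by (rule imageI)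
    then show "h \<in> rej (filter_model \<A>)"
      by (simp add: h)
  qed
  ultimately show ?thesis
    using pos_convex_cone_gambles_nonneg_on[OF consistent]
    by (auto simp: statement_model_def)
qed

text \<open>Bounds valid everywhere hold on any conjunction, which covers the background; the gamble
  built from \<open>C\<close> vanishes on \<open>C\<close>, which covers the assessment.\<close>

lemma prop_assessment_le_filter_model:
  assumes "\<A> \<noteq> {}" and consistent: "{} \<notin> conjunctions \<A>"
  shows "sup (prop_assessment \<A>) background \<le> filter_model \<A>"
proof -
  note nonneg_iff = gambles_nonneg_on_generated_filter_iff[OF consistent]
  note pos_iff = gambles_pos_on_generated_filter_iff[OF consistent]
  obtain B where B: "B \<in> conjunctions \<A>"
    using assms(1) conjunctions_superset by blast
  have "gambles_nonneg \<subseteq> gambles_nonneg_on (generated_filter \<A>)"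
    using B by (auto simp: nonneg_iff gambles_nonneg_iff)
  moreover have "gambles_pos \<subseteq> gambles_pos_on (generated_filter \<A>)"
    unfolding subset_eq Ball_def pos_iff gambles_pos_iff using B by blast
  moreover have "acc (prop_assessment \<A>) \<subseteq> gambles_nonneg_on (generated_filter \<A>)"
  proof
    fix f assume "f \<in> acc (prop_assessment \<A>)"
    then obtain C where "C \<in> \<A>" "f = indicator_gamble C - const_gamble 1"
      by (auto simp: prop_assessment_def)
    then show "f \<in> gambles_nonneg_on (generated_filter \<A>)"
      unfolding nonneg_iff using conjunctions_superset by (intro bexI[of _ C]) auto
  qed
  ultimately show ?thesis
    by (auto simp: less_eq_prod_def background_def prop_assessment_def)
qed

lemma filter_model_least:
  assumes consistent: "{} \<notin> conjunctions \<A>"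
    and M: "statement_model M" "sup (prop_assessment \<A>) background \<le> M"
  shows "filter_model \<A> \<le> M"
proof -
  have cone: "pos_convex_cone (acc M)"
    using M(1) by (simp add: statement_model_def)
  have sub: "acc (prop_assessment \<A>) \<subseteq> acc M" "gambles_nonneg \<subseteq> acc M"
    "uminus ` gambles_pos \<subseteq> rej M"
    using M(2) by (auto simp: less_eq_prod_def background_def)
  have posi_sub: "posi (acc (prop_assessment \<A>)) \<subseteq> acc M"
    by (rule posi_subset_pos_convex_cone[OF cone sub(1)])
  \<comment> \<open>Splits \<open>f\<close> into an accepted \<open>s\<close> and a remainder
    bounded below by \<open>d\<close> everywhere. The case \<open>d = 0\<close> serves acceptance,
    \<open>d > 0\<close> rejection.\<close>
  have decompose: "\<exists>s\<in>acc M. \<forall>x. d \<le> apply_gamble (f - s) x"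
    if B: "B \<in> conjunctions \<A>" "\<forall>x\<in>B. d \<le> apply_gamble f x" and d: "d \<ge> 0" for f B d
  proof -
    obtain s where s: "s \<in> posi (acc (prop_assessment \<A>))" "\<And>x. apply_gamble s x \<le> 0"
      "\<And>x. x \<notin> B \<Longrightarrow> apply_gamble s x \<le> -1"
      using conjunctions_penalty[OF B(1)] by metis
    obtain c where c: "c > 0" "\<And>x. \<bar>apply_gamble f x\<bar> \<le> c"
      using gamble_bounded[of f] by metis
    \<comment> \<open>Outside \<open>B\<close>, subtracting the multiple adds at least
      \<open>c + d\<close>: \<open>c\<close> offsets the lowest possible value of \<open>f\<close>,
      and \<open>d\<close> remains. On \<open>B\<close> it can only raise \<open>f\<close>.\<close>
    have "d \<le> apply_gamble (f - (c + d) *\<^sub>R s) x" for x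
    proof (cases "x \<in> B")
      case True
      have "(c + d) * apply_gamble s x \<le> 0"
        using c(1) d s(2)[of x] by (simp add: mult_nonneg_nonpos)
      then show ?thesis using B(2) True by fastforce
    next
      case False
      have "(c + d) * apply_gamble s x \<le> (c + d) * (-1)"
        using c(1) d s(3)[OF False] by (intro mult_left_mono) auto
      then show ?thesis using c(2)[of x] by simp
    qed
    moreover have "(c + d) *\<^sub>R s \<in> acc M"
      using cone posi_sub s(1) c(1) d by (auto simp: pos_convex_cone_def)
    ultimately show ?thesis by blast
  qed
  have "gambles_nonneg_on (generated_filter \<A>) \<subseteq> acc M"
  proof
    fix f assume "f \<in> gambles_nonneg_on (generated_filter \<A>)"
    then obtain s where s: "s \<in> acc M" "\<forall>x. 0 \<le> apply_gamble (f - s) x"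
      using decompose gambles_nonneg_on_generated_filter_iff[OF consistent] by blast
    then have "f - s \<in> acc M"
      using sub(2) gambles_nonneg_iff by blast
    then have "(f - s) + s \<in> acc M"
      using s(1) cone by (simp only: pos_convex_cone_def)
    then show "f \<in> acc M" by simp
  qed
  moreover have "uminus ` gambles_pos_on (generated_filter \<A>) \<subseteq> rej M"
  proof (intro image_subsetI)
    fix f assume "f \<in> gambles_pos_on (generated_filter \<A>)"
    then obtain B d where "B \<in> conjunctions \<A>" "d > 0" "\<forall>x\<in>B. d \<le> apply_gamble f x"
      using gambles_pos_on_generated_filter_iff[OF consistent] by blast
    then obtain s where s: "s \<in> acc M" "\<forall>x. d \<le> apply_gamble (f - s) x" and "d > 0"
      using decompose[of B d f] by auto
    then have "- (f - s) \<in> rej M"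
      using sub(3) gambles_pos_iff by blast
    \<comment> \<open>The factor 1 places the rejected gamble in \<open>sh (rej M)\<close>;
      subtracting the accepted \<open>s\<close> then yields \<open>- f\<close>, rejected by the last
      model axiom.\<close>
    then have "1 *\<^sub>R (- (f - s)) \<in> sh (rej M)"
      unfolding sh_def using zero_less_one by blast
    then have "1 *\<^sub>R (- (f - s)) - s \<in> minkowski_diff (sh (rej M)) (acc M)"
      unfolding minkowski_diff_def using s(1) by blast
    then have "1 *\<^sub>R (- (f - s)) - s \<in> rej M"
      using M(1) unfolding statement_model_def by blast
    then show "- f \<in> rej M" by simp
  qed
  ultimately show ?thesis
    by (simp add: less_eq_prod_def)
qed

text \<open>The accept cone of \<open>filter_model\<close> absorbs the whole \<open>posi\<close>,
  while a gamble rejected by the background is negative at every point of the non-empty conjunctions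
  and so stays outside that cone.\<close>

lemma consistent_if_no_empty_conjunction:
  assumes "\<A> \<noteq> {}" and consistent: "{} \<notin> conjunctions \<A>"
  shows "consistent background (prop_assessment \<A>)"
proof -
  have "posi (acc (prop_assessment \<A>) \<union> acc background) \<subseteq> gambles_nonneg_on (generated_filter \<A>)"
    using prop_assessment_le_filter_model[OF assms]
    by (intro posi_subset_pos_convex_cone pos_convex_cone_gambles_nonneg_on[OF consistent])
      (simp add: less_eq_prod_def)
  moreover have "- f \<notin> gambles_nonneg_on (generated_filter \<A>)" if f: "f \<in> gambles_pos" for f
  proof
    assume "- f \<in> gambles_nonneg_on (generated_filter \<A>)"
    then obtain B where B: "B \<in> conjunctions \<A>" "\<forall>x\<in>B. 0 \<le> apply_gamble (- f) x"
      using gambles_nonneg_on_generated_filter_iff[OF consistent] by blast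
    have "B \<noteq> {}" using B(1) consistent by metis
    then obtain x where "x \<in> B" by blast
    then have "apply_gamble f x \<le> 0" using B(2) by simp
    moreover obtain d where "d > 0" "\<forall>x. d \<le> apply_gamble f x"
      using f unfolding gambles_pos_iff by blast
    then have "0 < apply_gamble f x"
      by (blast intro: less_le_trans)
    ultimately show False by simp
  qed
  ultimately show ?thesis
    by (auto simp: consistent_def background_def prop_assessment_def)
qed

theorem proposition9:
  fixes \<A> :: "'x set set"
  assumes "\<A> \<noteq> {}"
  shows "(consistent background (prop_assessment \<A>) \<longleftrightarrow> {} \<notin> conjunctions \<A>) \<and>
    (consistent background (prop_assessment \<A>) \<longrightarrow>
      natural_extension background (prop_assessment \<A>) =
        (gambles_nonneg_on (generated_filter \<A>),
         uminus ` gambles_pos_on (generated_filter \<A>)))"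
proof -
  have iff: "consistent background (prop_assessment \<A>) \<longleftrightarrow> {} \<notin> conjunctions \<A>"
    using not_consistent_if_empty_conjunction consistent_if_no_empty_conjunction[OF assms] by blast
  have "natural_extension background (prop_assessment \<A>) = filter_model \<A>"
    if "{} \<notin> conjunctions \<A>"
    unfolding natural_extension_def
    using statement_model_filter_model[OF assms that] prop_assessment_le_filter_model[OF assms that]
      filter_model_least[OF that]
    by (rule cl_M_eqI)
  with iff show ?thesis by blast
qed

end
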